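(* Let $k>1$ be an integer. The concatenation of any two Landess permutiples, both with multiplier $k$, is again a Landess permutiple with multiplier $k$.
   Context: For positive integers $a_0,\ldots,a_n$, $[a_0;a_1,\ldots,a_n]$ denotes the finite simple continued fraction $a_0+1/(a_1+1/(\cdots+1/a_n))$; all finite continued fractions are assumed in canonical form (last digit at least $2$ when there are at least two digits). For an integer $k>1$ and a permutation $\sigma$ of $\{0,\ldots,n\}$, $r=[a_0;\ldots,a_n]$ is a $(\sigma,k)$-permutiple (with multiplier $k$) if $r=k\,[a_{\sigma(0)};a_{\sigma(1)},\ldots,a_{\sigma(n)}]$. Continuants: $K_0()=1$, $K_1(x_0)=x_0$, $K_m(x_0,\ldots,x_{m-1})=x_{m-1}K_{m-1}(x_0,\ldots,x_{m-2})+K_{m-2}(x_0,\ldots,x_{m-3})$. Let $p_j=K_{j+1}(a_0,\ldots,a_j)$, $q_j=K_j(a_1,\ldots,a_j)$, $p'_j=K_{j+1}(a_{\sigma(0)},\ldots,a_{\sigma(j)})$, $q'_j=K_j(a_{\sigma(1)},\ldots,a_{\sigma(j)})$. The permutiple is continuant-preserving if $p_n=p'_n$. It is a Landess permutiple if it is continuant-preserving and $q_{n-1}=q'_{n-1}$ and $p_{n-1}=k\,p'_{n-1}$. For $c_1=[b_0;\ldots,b_n]$, $c_2=[b'_0;\ldots,b'_m]$ the concatenation is $c_1\circ c_2=[b_0;\ldots,b_n,b'_0,\ldots,b'_m]$, regarded as a permutiple with respect to the permutation acting as the first permutation on the first $n+1$ positions and as the second (shifted by $n+1$) on the last $m+1$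 positions. *)

theory Defs
  imports Complex_Main "HOL-Combinatorics.Permutations"
begin

text \<open>
  The digits \<open>a\<^sub>0, \<dots>, a\<^sub>n\<close> are the entries of a list of length \<open>n + 1\<close>, and a permutation of
  \<open>{0, \<dots>, n}\<close> is a function \<open>\<sigma>\<close> with \<^term>\<open>\<sigma> permutes {..<length as}\<close>.  The digits
  \<open>a\<^bsub>\<sigma>(0)\<^esub>, \<dots>, a\<^bsub>\<sigma>(n)\<^esub>\<close> form the list \<^term>\<open>permute_list \<sigma> as\<close>.
\<close>

text \<open>The empty list is not a continued fraction; its value is a dummy.\<close>

fun cf_value :: "nat list \<Rightarrow> rat" where
  "cf_value [] = 0"
| "cf_value [a] = of_nat a"
| "cf_value (a # b # bs) = of_nat a + 1 / cf_value (b # bs)"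

definition canonical_cf :: "nat list \<Rightarrow> bool" where
  "canonical_cf as \<longleftrightarrow>
     as \<noteq> [] \<and> (\<forall>a \<in> set as. 0 < a) \<and> (2 \<le> length as \<longrightarrow> 2 \<le> last as)"

definition permutiple :: "(nat \<Rightarrow> nat) \<Rightarrow> nat \<Rightarrow> nat list \<Rightarrow> bool" where
  "permutiple \<sigma> k as \<longleftrightarrow>
     1 < k \<and> \<sigma> permutes {..<length as} \<and>
     canonical_cf as \<and> canonical_cf (permute_list \<sigma> as) \<and>
     cf_value as = of_nat k * cf_value (permute_list \<sigma> as)"

function continuant :: "nat list \<Rightarrow> nat" where
  "continuant [] = 1"
| "continuant [x] = x"
| "continuant (xs @ [y, x]) = x * continuant (xs @ [y]) + continuant xs"
proof -
  fix P and zs :: "nat list"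
  assume "zs = [] \<Longrightarrow> P" "\<And>x. zs = [x] \<Longrightarrow> P" "\<And>xs y x. zs = xs @ [y, x] \<Longrightarrow> P"
  then show P
    by (cases zs rule: rev_cases; cases "butlast zs" rule: rev_cases) auto
qed auto
termination by (relation "measure length") auto

text \<open>
  With \<open>K\<close> the continuant, \<^term>\<open>cf_num as j\<close> is \<open>p\<^sub>j = K(a\<^sub>0, \<dots>, a\<^sub>j)\<close> and \<^term>\<open>cf_den as j\<close> is
  \<open>q\<^sub>j = K(a\<^sub>1, \<dots>, a\<^sub>j)\<close>, for \<open>j \<le> n\<close>.
\<close>

definition cf_num :: "nat list \<Rightarrow> nat \<Rightarrow> nat" where
  "cf_num as j = continuant (take (j + 1) as)"

definition cf_den :: "nat list \<Rightarrow> nat \<Rightarrow> nat" where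
  "cf_den as j = continuant (take j (tl as))"

definition continuant_preserving :: "(nat \<Rightarrow> nat) \<Rightarrow> nat \<Rightarrow> nat list \<Rightarrow> bool" where
  "continuant_preserving \<sigma> k as \<longleftrightarrow>
     permutiple \<sigma> k as \<and>
     (let n = length as - 1 in cf_num as n = cf_num (permute_list \<sigma> as) n)"

text \<open>
  The index \<open>n - 1\<close> below is never truncated: a permutiple has at least two digits, see
  \<open>permutiple_length\<close>.
\<close>

definition landess_permutiple :: "(nat \<Rightarrow> nat) \<Rightarrow> nat \<Rightarrow> nat list \<Rightarrow> bool" where
  "landess_permutiple \<sigma> k as \<longleftrightarrow>
     continuant_preserving \<sigma> k as \<and>
     (let n = length as - 1; as' = permute_list \<sigma> as in
        cf_den as (n - 1) = cf_den as' (n - 1) \<and>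
        cf_num as (n - 1) = k * cf_num as' (n - 1))"

lemma permutiple_length:
  assumes "permutiple \<sigma> k as"
  shows "2 \<le> length as"
proof (rule ccontr)
  assume "\<not> 2 \<le> length as"
  moreover have "as \<noteq> []"
    using assms by (simp add: permutiple_def canonical_cf_def)
  ultimately obtain a where as: "as = [a]"
    by (cases as; cases "tl as") auto
  have "\<sigma> permutes {..<1}" "1 < k" "0 < a"
    using assms by (auto simp: permutiple_def canonical_cf_def as)
  moreover from this(1) have "\<sigma> 0 = 0"
    using permutes_in_image[of \<sigma> "{..<1}" 0] by simp
  ultimately have "(of_nat a :: rat) = of_nat (k * a)"
    using assms by (simp add: permutiple_def as permute_list_def)
  then have "a = k * a"
    by (simp only: of_nat_eq_iff)
  with \<open>1 < k\<close> \<open>0 < a\<close> show False by simp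
qed

text \<open>
  For \<open>\<sigma>\<close> permuting the first \<open>l\<close> positions, \<open>\<tau>\<close> acts on the positions after them; \<open>\<tau>\<close> is the
  identity beyond its own range, and so is the result.
\<close>

definition concat_perm :: "nat \<Rightarrow> (nat \<Rightarrow> nat) \<Rightarrow> (nat \<Rightarrow> nat) \<Rightarrow> nat \<Rightarrow> nat" where
  "concat_perm l \<sigma> \<tau> i = (if i < l then \<sigma> i else \<tau> (i - l) + l)"

end

theory Submission
  imports Defs
begin

text \<open>
  Put \<open>M = [[p\<^sub>n, p\<^bsub>n-1\<^esub>], [q\<^sub>n, q\<^bsub>n-1\<^esub>]]\<close>, which is multiplicative under concatenation of digit lists.
  Continuant preservation turns the value equation into \<open>q'\<^sub>n = k q\<^sub>n\<close>, so the Landess conditions say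
  exactly that \<open>M = D M' D\<^sup>-\<^sup>1\<close> with \<open>D = diag(k, 1)\<close>; such a relation is stable under products.
\<close>

text \<open>Euler's splitting identity. The induction grows \<open>ys\<close> at its right end,
  where the recursion of \<open>continuant\<close> acts, so both sides obey the same
  recurrence.\<close>

lemma continuant_append:
  "continuant (xs @ a # b # ys) =
     continuant (xs @ [a]) * continuant (b # ys) + continuant xs * continuant ys"
proof (induction ys rule: continuant.induct)
  case 1
  show ?case by (simp add: mult.commute)
next
  case (2 x)
  show ?case
    using continuant.simps(3)[of "xs @ [a]" b x] continuant.simps(3)[of "[]" b x]
      continuant.simps(3)[of xs a b]
    by (simp add: algebra_simps)
next
  case (3 zs y x)
  then show ?case
    using continuant.simps(3)[of "xs @ a # b # zs" y x] continuant.simps(3)[of "b # zs" y x]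
    by (simp add: algebra_simps)
qed

lemma continuant_append_nonempty:
  assumes "xs \<noteq> []" "ys \<noteq> []"
  shows "continuant (xs @ ys) =
    continuant xs * continuant ys + continuant (butlast xs) * continuant (tl ys)"
proof -
  obtain us a where "xs = us @ [a]"
    using assms(1) by (cases xs rule: rev_cases) auto
  moreover obtain b vs where "ys = b # vs"
    using assms(2) by (cases ys) auto
  ultimately show ?thesis
    by (simp add: continuant_append)
qed

text \<open>The four entries of the matrix product for \<open>xs @ ys\<close>. Blocks of one digit
  are excluded: there the lower right entry is 0, but \<open>butlast (tl [a])\<close> is empty and
  has continuant 1.\<close>

lemma continuant_block_append:
  assumes "xs \<noteq> []" "tl xs \<noteq> []" "ys \<noteq> []" "butlast ys \<noteq> []"
  shows "continuant (xs @ ys) =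
      continuant xs * continuant ys + continuant (butlast xs) * continuant (tl ys)"
    and "continuant (tl (xs @ ys)) =
      continuant (tl xs) * continuant ys + continuant (butlast (tl xs)) * continuant (tl ys)"
    and "continuant (butlast (xs @ ys)) = continuant xs * continuant (butlast ys)
      + continuant (butlast xs) * continuant (butlast (tl ys))"
    and "continuant (butlast (tl (xs @ ys))) = continuant (tl xs) * continuant (butlast ys)
      + continuant (butlast (tl xs)) * continuant (butlast (tl ys))"
  using assms by (simp_all add: continuant_append_nonempty butlast_append butlast_tl)

text \<open>The recurrence at the left end, where \<open>cf_value\<close> recurses.\<close>

lemma continuant_Cons_Cons:
  "continuant (a # b # ys) = a * continuant (b # ys) + continuant ys"
  using continuant_append[of "[]"] by simp

lemma continuant_pos:
  assumes "\<forall>x \<in> set xs. 0 < x"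
  shows "0 < continuant xs"
  using assms by (induction xs rule: continuant.induct) auto

lemma cf_value_eq_continuant_quotient:
  assumes "xs \<noteq> []" "\<forall>x \<in> set xs. 0 < x"
  shows "cf_value xs = of_nat (continuant xs) / of_nat (continuant (tl xs))"
  using assms
proof (induction xs rule: cf_value.induct)
  case (3 a b bs)
  then have "0 < continuant (b # bs)"
    by (intro continuant_pos) auto
  with 3 show ?case
    by (simp add: continuant_Cons_Cons field_simps)
qed auto

lemma concat_perm_comp:
  assumes "\<sigma>' permutes {..<l}"
  shows "concat_perm l \<sigma> \<tau> \<circ> concat_perm l \<sigma>' \<tau>' = concat_perm l (\<sigma> \<circ> \<sigma>') (\<tau> \<circ> \<tau>')"
  using permutes_in_image[OF assms] by (auto simp: concat_perm_def fun_eq_iff)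

lemma concat_perm_id: "concat_perm l id id = id"
  by (auto simp: concat_perm_def fun_eq_iff)

lemma concat_perm_permutes:
  assumes "\<sigma> permutes {..<l}" "\<tau> permutes {..<m}"
  shows "concat_perm l \<sigma> \<tau> permutes {..<l + m}"
proof -
  have "bij (concat_perm l \<sigma> \<tau>)"
    using concat_perm_comp[OF permutes_inv[OF assms(1)], of \<sigma> \<tau> "inv \<tau>"]
      concat_perm_comp[OF assms(1), of "inv \<sigma>" "inv \<tau>" \<tau>]
    \<comment> \<open>The two-sided inverse acts on each block by that block's inverse.\<close>
    by (intro o_bij[of "concat_perm l (inv \<sigma>) (inv \<tau>)"])
      (simp_all add: permutes_inv_o[OF assms(1)] permutes_inv_o[OF assms(2)] concat_perm_id)
  moreover have "concat_perm l \<sigma> \<tau> i = i" if "i \<notin> {..<l + m}" for i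
    using that permutes_not_in[OF assms(2), of "i - l"] by (auto simp: concat_perm_def)
  ultimately show ?thesis
    by (auto simp: permutes_def bij_iff)
qed

lemma permute_list_concat_perm:
  assumes "\<sigma> permutes {..<length xs}" "\<tau> permutes {..<length ys}"
  shows "permute_list (concat_perm (length xs) \<sigma> \<tau>) (xs @ ys) =
    permute_list \<sigma> xs @ permute_list \<tau> ys"
proof (rule nth_equalityI)
  fix i assume "i < length (permute_list (concat_perm (length xs) \<sigma> \<tau>) (xs @ ys))"
  then show "permute_list (concat_perm (length xs) \<sigma> \<tau>) (xs @ ys) ! i =
      (permute_list \<sigma> xs @ permute_list \<tau> ys) ! i"
    using permutes_in_image[OF assms(1), of i]
    by (auto simp: permute_list_def concat_perm_def nth_append)
qed simp

text \<open>A single digit 1 is canonical but must not end a longer expansion, hence the bound on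
  \<open>length ys\<close>.\<close>

lemma canonical_cf_append:
  assumes "canonical_cf xs" "canonical_cf ys" "2 \<le> length ys"
  shows "canonical_cf (xs @ ys)"
  using assms by (auto simp: canonical_cf_def)

text \<open>Both values are quotients of continuants with the same numerator; cancelling it leaves
  an equation between denominators in the natural numbers.\<close>

lemma permutiple_value_iff:
  assumes "canonical_cf xs" "canonical_cf ys" "continuant xs = continuant ys"
  shows "cf_value xs = of_nat k * cf_value ys \<longleftrightarrow>
    continuant (tl ys) = k * continuant (tl xs)"
proof -
  have pos: "xs \<noteq> []" "ys \<noteq> []" "\<forall>x\<in>set xs. 0 < x" "\<forall>y\<in>set ys. 0 < y"
    using assms by (auto simp: canonical_cf_def)
  have "0 < continuant (tl xs)" "0 < continuant (tl ys)" "0 < continuant ys"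
    using pos by (auto intro!: continuant_pos dest: list.set_sel(2))
  then have "cf_value xs = of_nat k * cf_value ys \<longleftrightarrow>
      (of_nat (continuant (tl ys)) :: rat) = of_nat (k * continuant (tl xs))"
    using assms(3) pos by (simp add: cf_value_eq_continuant_quotient field_simps)
  then show ?thesis by (simp only: of_nat_eq_iff)
qed

text \<open>The four continuant equations are the entries of \<open>M = D M' D^(-1)\<close>, written
  with \<open>tl\<close> and \<open>butlast\<close> so that the block formulas apply.\<close>

lemma landess_permutiple_iff_continuants:
  "landess_permutiple \<sigma> k as \<longleftrightarrow>
     (let as' = permute_list \<sigma> as in
      1 < k \<and> \<sigma> permutes {..<length as} \<and> 2 \<le> length as \<and>
      canonical_cf as \<and> canonical_cf as' \<and>
      continuant as = continuant as' \<and>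
      continuant (tl as') = k * continuant (tl as) \<and>
      continuant (butlast as) = k * continuant (butlast as') \<and>
      continuant (butlast (tl as)) = continuant (butlast (tl as')))"
proof (cases "2 \<le> length as")
  case True
  \<comment> \<open>The \<open>j + 1\<close> in \<open>cf_num\<close> undoes the second subtraction,
    which is not truncated for two or more digits.\<close>
  then have "length as - 1 - 1 + 1 = length as - 1"
    by simp
  with True have "cf_num xs (length as - 1) = continuant xs"
    "cf_num xs (length as - 1 - 1) = continuant (butlast xs)"
    "cf_den xs (length as - 1 - 1) = continuant (butlast (tl xs))"
    if "length xs = length as" for xs
    using that unfolding cf_num_def cf_den_def by (simp_all add: butlast_conv_take)
  with True show ?thesis
    using permutiple_value_iff[of as "permute_list \<sigma> as" k]
    by (auto simp: landess_permutiple_def continuant_preserving_def permutiple_def Let_def)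
next
  case False
  \<comment> \<open>Both sides are false: the left by \<open>permutiple_length\<close>, the right by
    its own length conjunct.\<close>
  then show ?thesis
    using permutiple_length[of \<sigma> k as]
    by (auto simp: landess_permutiple_def continuant_preserving_def Let_def)
qed

theorem theorem22:
  fixes k :: nat and \<sigma> \<tau> :: "nat \<Rightarrow> nat" and as bs :: "nat list"
  assumes "1 < k"
    and "landess_permutiple \<sigma> k as"
    and "landess_permutiple \<tau> k bs"
  shows "landess_permutiple (concat_perm (length as) \<sigma> \<tau>) k (as @ bs)"
proof -
  define as' bs' where "as' = permute_list \<sigma> as" and "bs' = permute_list \<tau> bs"
  note A = assms(2)[unfolded landess_permutiple_iff_continuants Let_def, folded as'_def]
  note B = assms(3)[unfolded landess_permutiple_iff_continuants Let_def, folded bs'_def]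
  have len: "length as' = length as" "length bs' = length bs"
    by (simp_all add: as'_def bs'_def)
  have ne: "xs \<noteq> []" "tl xs \<noteq> []" "butlast xs \<noteq> []" if "2 \<le> length xs" for xs :: "nat list"
    using that by (auto simp flip: length_greater_0_conv)
  have perm: "permute_list (concat_perm (length as) \<sigma> \<tau>) (as @ bs) = as' @ bs'"
    using A B by (simp add: permute_list_concat_perm as'_def bs'_def)
  have "concat_perm (length as) \<sigma> \<tau> permutes {..<length (as @ bs)}"
    using A B by (simp add: concat_perm_permutes)
  moreover have "canonical_cf (as @ bs)" "canonical_cf (as' @ bs')"
    using A B len by (simp_all add: canonical_cf_append)
  \<comment> \<open>After expansion the factors \<open>k\<close> move between the blocks: in the
    first equation, the \<open>k\<close> from \<open>butlast as\<close> joins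
    \<open>continuant (tl bs)\<close> to give \<open>continuant (tl bs')\<close>.\<close>
  moreover have "continuant (as @ bs) = continuant (as' @ bs')"
    "continuant (tl (as' @ bs')) = k * continuant (tl (as @ bs))"
    "continuant (butlast (as @ bs)) = k * continuant (butlast (as' @ bs'))"
    "continuant (butlast (tl (as @ bs))) = continuant (butlast (tl (as' @ bs')))"
    \<comment> \<open>\<open>tl_append2\<close> would push \<open>tl\<close> into the first block
      before the block formulas could match.\<close>
    using A B len by (simp_all add: continuant_block_append ne algebra_simps del: tl_append2)
  ultimately show ?thesis
    using A B perm by (simp add: landess_permutiple_iff_continuants Let_def)
qed

end
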